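(* Let $p$ and $q$ be distinct prime numbers. Then every clone on $\mathbb{Z}_{pq}$ containing $\mathrm{Clo}(\langle\mathbb{Z}_{pq},+\rangle)$ can be generated by a set of functions of arity at most $\max(\{p,q\})$.
   Context: A clone on a set $A$ is a set of finitary operations on $A$ containing all projections and closed under composition; it is generated by a set $S$ of operations if it is the smallest clone containing $S$. $\mathrm{Clo}(\langle \mathbb{Z}_{pq},+\rangle)$ is the clone on $\mathbb{Z}_{pq}$ generated by the addition. *)

theory Defs
  imports "HOL-Algebra.Elementary_Groups" "HOL-Library.FuncSet"
    "HOL-Computational_Algebra.Primes"
begin

definition tuples :: "'a set \<Rightarrow> nat \<Rightarrow> 'a list set" where
  "tuples A n = {xs. length xs = n \<and> set xs \<subseteq> A}"

text \<open>
  A finitary operation on \<open>A\<close> is a pair of its arity \<open>n\<close> and a function from \<open>A\<^sup>n\<close> to \<open>A\<close>,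
  extensional outside \<open>A\<^sup>n\<close> so that equality of operations is equality as functions on \<open>A\<^sup>n\<close>.
  Nullary operations are admitted but not required: a clone in the convention where all arities
  are positive is exactly a clone below that contains no nullary operation, and a set of
  operations of positive arity generates the same clone in either convention.
\<close>

type_synonym 'a operation = "nat \<times> ('a list \<Rightarrow> 'a)"

abbreviation arity :: "'a operation \<Rightarrow> nat" where
  "arity \<equiv> fst"

definition operations :: "'a set \<Rightarrow> 'a operation set" where
  "operations A = {(n, f). f \<in> tuples A n \<rightarrow>\<^sub>E A}"

definition projection :: "'a set \<Rightarrow> nat \<Rightarrow> nat \<Rightarrow> 'a operation" where
  "projection A n i = (n, \<lambda>xs\<in>tuples A n. xs ! i)"

text \<open>
  The \<open>m\<close>-ary operation \<open>f (g\<^sub>1, \<dots>, g\<^sub>n)\<close>; the arity \<open>m\<close> of the \<open>g\<^sub>i\<close> is an explicit argument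
  because the list of the \<open>g\<^sub>i\<close> is empty when \<open>f\<close> is nullary.
\<close>

definition composition ::
    "'a set \<Rightarrow> nat \<Rightarrow> 'a operation \<Rightarrow> 'a operation list \<Rightarrow> 'a operation" where
  "composition A m f gs = (m, \<lambda>xs\<in>tuples A m. snd f (map (\<lambda>g. snd g xs) gs))"

definition clone_on :: "'a set \<Rightarrow> 'a operation set \<Rightarrow> bool" where
  "clone_on A C \<longleftrightarrow>
     C \<subseteq> operations A \<and>
     (\<forall>n. \<forall>i<n. projection A n i \<in> C) \<and>
     (\<forall>m. \<forall>f\<in>C. \<forall>gs. length gs = arity f \<longrightarrow> (\<forall>g\<in>set gs. g \<in> C \<and> arity g = m) \<longrightarrow>
        composition A m f gs \<in> C)"

definition generated_clone :: "'a set \<Rightarrow> 'a operation set \<Rightarrow> 'a operation set" where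
  "generated_clone A S = \<Inter>{C. clone_on A C \<and> S \<subseteq> C}"

definition group_operation :: "('a, 'b) monoid_scheme \<Rightarrow> 'a operation" where
  "group_operation G = (2, \<lambda>xs\<in>tuples (carrier G) 2. xs ! 0 \<otimes>\<^bsub>G\<^esub> xs ! 1)"

definition Clo :: "('a, 'b) monoid_scheme \<Rightarrow> 'a operation set" where
  "Clo G = generated_clone (carrier G) {group_operation G}"

end

theory Submission
  imports Defs "HOL-Number_Theory.Number_Theory"
begin

text \<open>
  Choose an integer \<open>e\<close> with \<open>e = 1\<close> mod \<open>p\<close> and \<open>e = 0\<close> mod \<open>q\<close>. Multiplication by \<open>e\<close> and
  by \<open>1 - e\<close> lies in every clone containing the addition, so an operation may be studied
  through its values mod \<open>p\<close> and its values mod \<open>q\<close> separately, and every variable may be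
  replaced by a mixture \<open>e x + (1 - e) y\<close> of a variable \<open>x\<close> that counts mod \<open>p\<close> and a variable
  \<open>y\<close> that counts mod \<open>q\<close>. Up to exchanging the primes, one has to understand the functions
  \<open>g(x, y)\<close> with values mod \<open>p\<close> that arise in this way. They are closed under linear
  combinations, under substituting such functions for the \<open>x\<close>'s, and under linear
  substitutions in the \<open>y\<close>'s.

  The variables \<open>y\<close>. A function \<open>r(y, z)\<close> on the plane over the field with \<open>q\<close> elements equals,
  up to a constant and the factor \<open>q\<close>, a sum of terms \<open>\<plusminus> r(a t, b t)\<close> in which \<open>t\<close> is a linear form
  in \<open>y\<close> and \<open>z\<close> (\<open>line_interpolation_cong\<close>). Since \<open>q\<close> is invertible mod \<open>p\<close>, a function of
  several \<open>y\<close>'s is recovered from its restrictions to lines, which have one \<open>y\<close> fewer, and so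
  repeatedly until only \<open>y\<^sub>0\<close> is left (\<open>finitary_transfer\<close>).

  The variables \<open>x\<close>. As a function of one \<open>x\<close>, \<open>g\<close> is a polynomial of degree less than \<open>p\<close>, and
  substituting \<open>\<mu> x\<close> for \<open>x\<close> with varying \<open>\<mu>\<close> isolates its homogeneous parts \<open>x^d c\<close>. For
  \<open>d < p\<close> the factor \<open>x^d\<close> can be polarised into a product of \<open>d\<close> distinct variables, from
  which it is recovered by identifying them. So everything reduces to functions
  \<open>x\<^sub>0 \<dots> x\<^sub>d\<^sub>-\<^sub>1 r(y\<^sub>0)\<close> (\<open>product_times_transfer\<close>).

  The degree. If \<open>d\<close> exceeds \<open>p\<close>, identifying \<open>p\<close> of the variables lowers the degree to
  \<open>d - p + 1 \<ge> 2\<close>, by Fermat's little theorem. Conversely, substituting a product of degree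
  at least 2 into itself until \<open>p\<close> copies are used raises the degree to at least \<open>d\<close> while
  \<open>r^p = r\<close>, and identifying variables then brings it down to exactly \<open>d\<close>
  (\<open>initial_product_transfer\<close>). Hence the products of degree at most \<open>max p q\<close> suffice, and
  they need no more than \<open>max p q\<close> variables.
\<close>

section \<open>Identities modulo a prime\<close>

lemma fermat_int:
  fixes a :: int
  assumes "prime p" and "\<not> [a = 0] (mod int p)"
  shows "[a ^ (p - 1) = 1] (mod int p)"
proof -
  have "p > 0" using assms(1) prime_gt_0_nat by blast
  define b where "b = nat (a mod int p)"
  have ab: "[int b = a] (mod int p)" using \<open>p > 0\<close> by (simp add: b_def)
  have "\<not> p dvd b"
  proof
    assume "p dvd b"
    then have "[int b = 0] (mod int p)" by (simp add: cong_0_iff)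
    then show False using assms(2) cong_trans[OF cong_sym[OF ab]] by blast
  qed
  then have "[b ^ (p - 1) = 1] (mod p)" by (rule fermat_theorem[OF assms(1)])
  then have "[int b ^ (p - 1) = 1] (mod int p)"
    using cong_int_iff[of "b ^ (p - 1)" 1 p] by simp
  then show ?thesis using cong_trans[OF cong_sym[OF cong_pow[OF ab]]] by blast
qed

lemma coprime_int_prime:
  assumes "prime p" and "\<not> [t = 0] (mod int p)"
  shows "coprime t (int p)"
  using assms prime_imp_coprime[of "int p" t] by (simp add: cong_0_iff coprime_commute)

lemma fermat_power_shift:
  fixes a :: int
  assumes "prime p" and "k > 0"
  shows "[a ^ (k + n * (p - 1)) = a ^ k] (mod int p)"
proof (cases "[a = 0] (mod int p)")
  case True
  have "[a ^ j = 0] (mod int p)" if "j > 0" for j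
    using cong_pow[OF True, of j] that by (simp add: zero_power)
  from this[of k] this[of "k + n * (p - 1)"] show ?thesis
    using assms(2) by (auto simp: cong_def)
next
  case False
  have "[a ^ k * (a ^ (p - 1)) ^ n = a ^ k * 1 ^ n] (mod int p)"
    by (intro cong_mult cong_pow cong_refl fermat_int assms False)
  moreover have "a ^ (k + n * (p - 1)) = a ^ k * (a ^ (p - 1)) ^ n"
    by (simp only: power_add power_mult[symmetric] mult.commute[of n])
  ultimately show ?thesis by simp
qed

lemma sum_affine_reindex_cong:
  fixes \<phi> :: "int \<Rightarrow> int"
  assumes "n > 0" and "coprime t (int n)"
    and \<phi>: "\<And>a b. [a = b] (mod int n) \<Longrightarrow> [\<phi> a = \<phi> b] (mod m)"
  shows "[(\<Sum>\<mu>=0..<int n. \<phi> (t * \<mu> + s)) = (\<Sum>\<mu>=0..<int n. \<phi> \<mu>)] (mod m)"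
proof -
  define h where "h \<mu> = (t * \<mu> + s) mod int n" for \<mu>
  have "inj_on h {0..<int n}"
  proof (rule inj_onI)
    fix a b assume a: "a \<in> {0..<int n}" and b: "b \<in> {0..<int n}" and "h a = h b"
    then have "[t * a + s = t * b + s] (mod int n)" by (simp add: h_def cong_def)
    then have "[t * a = t * b] (mod int n)" by (simp add: cong_add_rcancel)
    then have "[a = b] (mod int n)" using assms(2) cong_mult_lcancel by blast
    then show "a = b" using a b by (simp add: cong_def)
  qed
  moreover have "h ` {0..<int n} \<subseteq> {0..<int n}" using assms(1) by (auto simp: h_def)
  ultimately have bij: "bij_betw h {0..<int n} {0..<int n}"
    by (simp add: bij_betw_def endo_inj_surj)
  have "[(\<Sum>\<mu>=0..<int n. \<phi> (t * \<mu> + s)) = (\<Sum>\<mu>=0..<int n. \<phi> (h \<mu>))] (mod m)"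
    by (intro cong_sum \<phi>) (simp add: h_def cong_def)
  also have "(\<Sum>\<mu>=0..<int n. \<phi> (h \<mu>)) = (\<Sum>\<mu>=0..<int n. \<phi> \<mu>)"
    by (rule sum.reindex_bij_betw[OF bij])
  finally show ?thesis .
qed

text \<open>
  Multiplying the summation variable by a primitive root \<open>g\<close> permutes the residues and
  multiplies the sum by \<open>g^k\<close>, which is not 1.
\<close>

lemma power_sum_cong_0:
  assumes p: "prime p" and "0 < k" "k < p - 1"
  shows "[(\<Sum>\<mu>=0..<int p. \<mu> ^ k) = 0] (mod int p)"
proof -
  obtain g where g: "residue_primroot p g" using prime_primitive_root_exists[OF prime_gt_1_nat[OF p] p] by blast
  have ord: "ord p g = p - 1" and co: "coprime p g"
    using g by (auto simp: residue_primroot_def totient_prime[OF p])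
  have "\<not> [g ^ k = 1] (mod p)"
    using assms ord by (metis ord_divides nat_dvd_not_less)
  then have ne: "\<not> [int g ^ k = 1] (mod int p)"
    using cong_int_iff[of "g ^ k" 1 p] by simp
  let ?S = "\<Sum>\<mu>=0..<int p. \<mu> ^ k"
  have "[(\<Sum>\<mu>=0..<int p. (int g * \<mu> + 0) ^ k) = ?S] (mod int p)"
    by (rule sum_affine_reindex_cong[where \<phi> = "\<lambda>\<mu>. \<mu> ^ k"])
       (use co p in \<open>auto intro: cong_pow simp: coprime_commute prime_gt_0_nat\<close>)
  then have "[int g ^ k * ?S = ?S] (mod int p)"
    by (simp add: power_mult_distrib sum_distrib_left)
  then have "int p dvd (int g ^ k - 1) * ?S"
    by (simp add: cong_iff_dvd_diff algebra_simps)
  then show ?thesis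
    using ne p by (simp add: cong_iff_dvd_diff prime_dvd_mult_iff)
qed

text \<open>
  The homogeneous part of degree \<open>d\<close>, for \<open>1 \<le> d \<le> p - 1\<close>, of the polynomial that induces
  \<open>k\<close> mod \<open>p\<close>. Writing it with the dilates \<open>k(\<mu> t)\<close> makes it visible that it belongs to every
  linear space of functions that contains \<open>k\<close> and is closed under dilation. Subtracting
  \<open>k 0\<close> makes the formula correct at \<open>t = 0\<close> too, and for \<open>d = p - 1\<close>, where the coefficient
  at \<open>\<mu> = 0\<close> is \<open>0^0 = 1\<close>.
\<close>
definition homogeneous_part :: "nat \<Rightarrow> nat \<Rightarrow> (int \<Rightarrow> int) \<Rightarrow> int \<Rightarrow> int" where
  "homogeneous_part p d k t = - (\<Sum>\<mu>=0..<int p. \<mu> ^ (p - 1 - d) * (k (\<mu> * t) - k 0))"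

text \<open>
  For \<open>t \<noteq> 0\<close>, replacing \<open>\<mu>\<close> by \<open>t \<mu>\<close> in the sum at the argument 1 gives
  \<open>t^(p - 1 - d)\<close> times the sum at the argument \<open>t\<close>, and \<open>t^(p - 1) = 1\<close>.
\<close>

lemma homogeneous_part_eq_power_mult:
  assumes p: "prime p" and d: "1 \<le> d" "d \<le> p - 1"
    and k: "\<And>a b. [a = b] (mod int p) \<Longrightarrow> [k a = k b] (mod int p)"
  shows "[homogeneous_part p d k t = t ^ d * homogeneous_part p d k 1] (mod int p)"
proof (cases "[t = 0] (mod int p)")
  case True
  have "[homogeneous_part p d k t = - (\<Sum>\<mu>=0..<int p. \<mu> ^ (p - 1 - d) * (k 0 - k 0))] (mod int p)"
    unfolding homogeneous_part_def cong_minus_minus_iff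
    using cong_scalar_left[OF True] by (intro cong_sum cong_mult cong_diff k cong_refl) simp
  moreover have "[t ^ d * homogeneous_part p d k 1 = 0 ^ d * homogeneous_part p d k 1] (mod int p)"
    by (intro cong_mult cong_pow cong_refl True)
  ultimately show ?thesis using d by (simp add: zero_power cong_def)
next
  case False
  then have co: "coprime t (int p)"
    by (rule coprime_int_prime[OF p])
  define \<phi> where "\<phi> \<mu> = \<mu> ^ (p - 1 - d) * (k \<mu> - k 0)" for \<mu>
  have \<phi>: "[\<phi> a = \<phi> b] (mod int p)" if "[a = b] (mod int p)" for a b
    unfolding \<phi>_def by (intro cong_mult cong_diff cong_pow k cong_refl that)
  have "[(\<Sum>\<mu>=0..<int p. \<phi> (t * \<mu> + 0)) = (\<Sum>\<mu>=0..<int p. \<phi> \<mu>)] (mod int p)"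
    by (rule sum_affine_reindex_cong) (use p co \<phi> in \<open>auto simp: prime_gt_0_nat\<close>)
  then have "[t ^ d * (\<Sum>\<mu>=0..<int p. \<phi> (t * \<mu>)) = t ^ d * (\<Sum>\<mu>=0..<int p. \<phi> \<mu>)] (mod int p)"
    by (simp add: cong_scalar_left)
  moreover have "t ^ d * \<phi> (t * \<mu>) = t ^ (p - 1) * (\<mu> ^ (p - 1 - d) * (k (\<mu> * t) - k 0))" for \<mu>
  proof -
    have t: "t ^ (p - 1) = t ^ d * t ^ (p - 1 - d)"
      using power_add[of t d "p - 1 - d"] d by simp
    show ?thesis unfolding t by (simp add: \<phi>_def power_mult_distrib mult_ac)
  qed
  ultimately have "[t ^ (p - 1) * homogeneous_part p d k t = t ^ d * homogeneous_part p d k 1] (mod int p)"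
    by (simp only: homogeneous_part_def sum_distrib_left mult_minus_right cong_minus_minus_iff \<phi>_def mult_1_right)
  moreover have "[t ^ (p - 1) * homogeneous_part p d k t = 1 * homogeneous_part p d k t] (mod int p)"
    by (intro cong_mult cong_refl fermat_int p False)
  ultimately show ?thesis by (simp add: cong_def)
qed

text \<open>
  Summed over \<open>d\<close>, the weights of \<open>k(\<mu> t) - k 0\<close> form the geometric sum
  \<open>1 + \<mu> + \<dots> + \<mu>^(p - 2)\<close>, which vanishes mod \<open>p\<close> unless \<open>\<mu>\<close> is 0 or 1. It equals
  \<open>p - 1 = -1\<close> at \<open>\<mu> = 1\<close>, and the term at \<open>\<mu> = 0\<close> is zero.
\<close>

lemma homogeneous_decomposition:
  assumes p: "prime p"
    and k: "\<And>a b. [a = b] (mod int p) \<Longrightarrow> [k a = k b] (mod int p)"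
  shows "[k t = k 0 + (\<Sum>d=1..p-1. homogeneous_part p d k t)] (mod int p)"
proof -
  have p1: "p > 1" using p prime_gt_1_nat by blast
  let ?G = "\<lambda>\<mu>::int. \<Sum>j<p-1. \<mu> ^ j"
  have "(\<Sum>d=1..p-1. \<mu> ^ (p - 1 - d)) = ?G \<mu>" for \<mu> :: int
    by (rule sum.reindex_bij_witness[where i = "\<lambda>j. p - 1 - j" and j = "\<lambda>d. p - 1 - d"]) auto
  then have "(\<Sum>d=1..p-1. homogeneous_part p d k t) = - (\<Sum>\<mu>=0..<int p. ?G \<mu> * (k (\<mu> * t) - k 0))"
    unfolding homogeneous_part_def sum_negf
    by (subst sum.swap) (simp add: sum_distrib_right[symmetric])
  moreover have "[(\<Sum>\<mu>=0..<int p. ?G \<mu> * (k (\<mu> * t) - k 0)) = (\<Sum>\<mu>=0..<int p. if \<mu> = 1 then - (k t - k 0) else 0)] (mod int p)"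
  proof (rule cong_sum)
    fix \<mu> assume mu: "\<mu> \<in> {0..<int p}"
    consider "\<mu> = 0" | "\<mu> = 1" | "\<mu> > 1" using mu by fastforce
    then show "[?G \<mu> * (k (\<mu> * t) - k 0) = (if \<mu> = 1 then - (k t - k 0) else 0)] (mod int p)"
    proof cases
      case 2
      have "[int (p - 1) * (k t - k 0) = (- 1) * (k t - k 0)] (mod int p)"
        by (intro cong_mult cong_refl) (use p1 in \<open>simp add: cong_iff_dvd_diff of_nat_diff\<close>)
      then show ?thesis using 2 by simp
    next
      case 3
      have "\<not> [\<mu> = 0] (mod int p)" using 3 mu by (simp add: cong_def)
      then have "int p dvd \<mu> ^ (p - 1) - 1" using fermat_int[OF p] cong_iff_dvd_diff by blast
      then have "int p dvd (\<mu> - 1) * ?G \<mu>" by (simp add: power_diff_1_eq)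
      moreover have "\<not> int p dvd \<mu> - 1" using 3 mu by (auto dest: zdvd_imp_le)
      ultimately have "int p dvd ?G \<mu>" using p by (simp add: prime_dvd_mult_iff)
      then show ?thesis using 3 by (simp add: cong_0_iff)
    qed simp
  qed
  moreover have "(\<Sum>\<mu>=0..<int p. if \<mu> = 1 then - (k t - k 0) else 0) = - (k t - k 0)"
    using p1 by simp
  ultimately have "[(\<Sum>d=1..p-1. homogeneous_part p d k t) = k t - k 0] (mod int p)"
    by (simp add: cong_minus_minus_iff[symmetric, of _ "k t - k 0"])
  then have "[k 0 + (\<Sum>d=1..p-1. homogeneous_part p d k t) = k 0 + (k t - k 0)] (mod int p)"
    using cong_add cong_refl by blast
  then show ?thesis by (simp add: cong_sym)
qed

text \<open>
  The left-hand side extracts the part of \<open>(t + s)^d\<close> that is linear in \<open>s\<close>: after the binomial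
  expansion, \<open>s^j\<close> is weighted with minus the sum of all \<open>\<mu>^(p - 2 + j)\<close>, which is 1 for
  \<open>j = 1\<close> and 0 for \<open>2 \<le> j \<le> d\<close>.
\<close>

lemma polarisation_cong:
  fixes t s :: int
  assumes p: "prime p" and d: "2 \<le> d" "d \<le> p - 1"
  shows "[(\<Sum>\<mu>=0..<int p. - (\<mu> ^ (p - 2)) * ((t + \<mu> * s) ^ d - t ^ d)) = int d * t ^ (d - 1) * s] (mod int p)"
proof -
  let ?c = "\<lambda>j. int (d choose j) * s ^ j * t ^ (d - j)"
  have bin: "(t + \<mu> * s) ^ d - t ^ d = (\<Sum>j=1..d. \<mu> ^ j * ?c j)" for \<mu>
  proof -
    have "(t + \<mu> * s) ^ d = (\<Sum>j\<le>d. of_nat (d choose j) * (\<mu> * s) ^ j * t ^ (d - j))"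
      by (subst add.commute) (rule binomial_ring)
    also have "\<dots> = t ^ d + (\<Sum>j=1..d. of_nat (d choose j) * (\<mu> * s) ^ j * t ^ (d - j))"
      by (simp add: atMost_atLeast0 sum.atLeast_Suc_atMost)
    finally show ?thesis by (simp add: power_mult_distrib mult_ac)
  qed
  have sums: "[(\<Sum>\<mu>=0..<int p. \<mu> ^ (p - 2 + j)) = (if j = 1 then - 1 else 0)] (mod int p)"
    if j: "j \<in> {1..d}" for j
  proof (cases "j = 1")
    case True
    have "[(\<Sum>\<mu>=0..<int p. \<mu> ^ (p - 2 + j)) = (\<Sum>\<mu>=0..<int p. if \<mu> = 0 then 0 else 1)] (mod int p)"
    proof (rule cong_sum)
      fix \<mu> assume mu: "\<mu> \<in> {0..<int p}"
      have e: "p - 2 + j = p - 1" using True d by simp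
      show "[\<mu> ^ (p - 2 + j) = (if \<mu> = 0 then 0 else 1)] (mod int p)"
      proof (cases "\<mu> = 0")
        case True then show ?thesis using d e by (simp add: zero_power)
      next
        case False
        then have "\<not> [\<mu> = 0] (mod int p)" using mu by (simp add: cong_def)
        then show ?thesis using False e fermat_int[OF p] by simp
      qed
    qed
    also have "(\<Sum>\<mu>=0..<int p. if \<mu> = 0 then 0 else 1::int) = (\<Sum>\<mu>\<in>{0..<int p} - {0}. 1)"
      by (rule sum.mono_neutral_cong_right) auto
    also have "\<dots> = int p - 1" using d by (simp add: of_nat_diff)
    finally have "[(\<Sum>\<mu>=0..<int p. \<mu> ^ (p - 2 + j)) = int p - 1] (mod int p)" .
    moreover have "[int p - 1 = - 1] (mod int p)" by (simp add: cong_iff_dvd_diff)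
    ultimately show ?thesis using True cong_trans by auto
  next
    case False
    have e: "p - 2 + j = (j - 1) + 1 * (p - 1)"
      unfolding mult_1 using False d j[unfolded atLeastAtMost_iff] by linarith
    have "[(\<Sum>\<mu>=0..<int p. \<mu> ^ (p - 2 + j)) = (\<Sum>\<mu>=0..<int p. \<mu> ^ (j - 1))] (mod int p)"
      unfolding e by (intro cong_sum fermat_power_shift p) (use False j in simp)
    also have "[(\<Sum>\<mu>=0..<int p. \<mu> ^ (j - 1)) = 0] (mod int p)"
      by (rule power_sum_cong_0[OF p]) (use False j d in auto)
    finally show ?thesis using False by simp
  qed
  have "(\<Sum>\<mu>=0..<int p. - (\<mu> ^ (p - 2)) * ((t + \<mu> * s) ^ d - t ^ d))
      = (\<Sum>j=1..d. - (?c j) * (\<Sum>\<mu>=0..<int p. \<mu> ^ (p - 2 + j)))"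
    unfolding bin sum_distrib_left by (subst sum.swap) (simp add: power_add mult_ac)
  also have "[\<dots> = (\<Sum>j=1..d. - (?c j) * (if j = 1 then - 1 else 0))] (mod int p)"
    by (intro cong_sum cong_mult cong_refl sums)
  also have "(\<Sum>j=1..d. - (?c j) * (if j = 1 then - 1 else 0)) = (\<Sum>j=1..d. if j = 1 then ?c j else 0)"
    by (intro sum.cong) auto
  also have "\<dots> = int d * t ^ (d - 1) * s" using d by simp
  finally show ?thesis .
qed

text \<open>
  Over the field with \<open>q\<close> elements, the first sum runs over the lines through the origin
  spanned by \<open>(1, c)\<close>, and the last one treats the line spanned by \<open>(0, 1)\<close>. A line contributes
  only if it contains \<open>(y, z)\<close>: otherwise both arguments run through the whole line as \<open>b\<close>
  varies, and the two halves cancel. If it does contain \<open>(y, z)\<close>, then all \<open>q\<close> terms are equal to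
  \<open>r y z - r 0 0\<close>.
\<close>

lemma line_interpolation_cong:
  fixes r :: "int \<Rightarrow> int \<Rightarrow> int"
  assumes q: "prime q"
    and r: "\<And>a a' b b'. [a = a'] (mod int q) \<Longrightarrow> [b = b'] (mod int q) \<Longrightarrow> [r a b = r a' b'] (mod m)"
  shows "[int q * (r y z - r 0 0) =
      (\<Sum>c=0..<int q. \<Sum>b=0..<int q. r (y + b * (z - c * y)) (c * (y + b * (z - c * y)))
                                   - r (b * (z - c * y)) (c * (b * (z - c * y))))
      + (\<Sum>b=0..<int q. r 0 (z + b * y) - r 0 (b * y))] (mod m)"
proof -
  have q0: "q > 0" using q prime_gt_0_nat by blast
  \<comment> \<open>The contribution of one line: \<open>u + b v\<close> is constant in \<open>b\<close> or runs through all residues.\<close>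
  have cancel: "[(\<Sum>b=0..<int q. \<phi> (u + b * v) - \<phi> (b * v)) =
      (if [v = 0] (mod int q) then int q * (\<phi> u - \<phi> 0) else 0)] (mod m)"
    if \<phi>: "\<And>a b. [a = b] (mod int q) \<Longrightarrow> [\<phi> a = \<phi> b] (mod m)" for \<phi> u v
  proof (cases "[v = 0] (mod int q)")
    case True
    have bv: "[b * v = 0] (mod int q)" for b using cong_scalar_left[OF True, of b] by simp
    have "[(\<Sum>b=0..<int q. \<phi> (u + b * v) - \<phi> (b * v)) = (\<Sum>b=0..<int q. \<phi> u - \<phi> 0)] (mod m)"
      using cong_add[OF cong_refl bv] by (intro cong_sum cong_diff \<phi> bv) simp
    then show ?thesis using True by simp
  next
    case False
    then have co: "coprime v (int q)"
      by (rule coprime_int_prime[OF q])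
    have "[(\<Sum>b=0..<int q. \<phi> (v * b + u)) - (\<Sum>b=0..<int q. \<phi> (v * b + 0))
        = (\<Sum>b=0..<int q. \<phi> b) - (\<Sum>b=0..<int q. \<phi> b)] (mod m)"
      by (intro cong_diff sum_affine_reindex_cong q0 co \<phi>)
    then show ?thesis using False by (simp add: sum_subtractf algebra_simps)
  qed
  let ?I = "\<lambda>c. \<Sum>b=0..<int q. r (y + b * (z - c * y)) (c * (y + b * (z - c * y)))
                                   - r (b * (z - c * y)) (c * (b * (z - c * y)))"
  let ?L = "\<Sum>b=0..<int q. r 0 (z + b * y) - r 0 (b * y)"
  have I: "[?I c = (if [z - c * y = 0] (mod int q) then int q * (r y (c * y) - r 0 0) else 0)] (mod m)" for c
    by (rule cancel[of "\<lambda>t. r t (c * t)" y "z - c * y", unfolded mult_zero_right])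
       (intro r cong_mult cong_refl)
  have L: "[?L = (if [y = 0] (mod int q) then int q * (r 0 z - r 0 0) else 0)] (mod m)"
    using cancel[of "r 0" z y] r by simp
  have IL: "[(\<Sum>c=0..<int q. ?I c) + ?L = (\<Sum>c=0..<int q. if [z - c * y = 0] (mod int q) then int q * (r y (c * y) - r 0 0) else 0)
      + (if [y = 0] (mod int q) then int q * (r 0 z - r 0 0) else 0)] (mod m)" (is "[_ = ?I' + ?L'] (mod m)")
    by (intro cong_add cong_sum I L)
  have "[?I' + ?L' = int q * (r y z - r 0 0)] (mod m)"
  proof (cases "[y = 0] (mod int q)")
    case True
    have "[?I' = (\<Sum>c=0..<int q. 0)] (mod m)"
    proof (rule cong_sum)
      fix c
      have "[int q * (r y (c * y) - r 0 0) = int q * (r 0 0 - r 0 0)] (mod m)"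
        by (intro cong_mult cong_diff cong_refl r True) (use cong_scalar_left[OF True, of c] in simp)
      then show "[(if [z - c * y = 0] (mod int q) then int q * (r y (c * y) - r 0 0) else 0) = 0] (mod m)"
        by simp
    qed
    moreover have "[?L' = int q * (r y z - r 0 0)] (mod m)"
      unfolding if_P[OF True] by (intro cong_mult cong_diff cong_refl r cong_sym[OF True])
    ultimately show ?thesis using cong_add by fastforce
  next
    case False
    then have co: "coprime y (int q)"
      by (rule coprime_int_prime[OF q])
    \<comment> \<open>The only line that contributes has slope \<open>c0 = z / y\<close>.\<close>
    then obtain y' where y': "[y * y' = 1] (mod int q)" using cong_solve_coprime_int by blast
    define c0 where "c0 = (z * y') mod int q"
    have c0: "c0 \<in> {0..<int q}" using q0 by (simp add: c0_def)
    have "[c0 * y = (z * y') * y] (mod int q)" by (simp add: c0_def cong_def mod_mult_left_eq)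
    moreover have "[z * (y * y') = z * 1] (mod int q)" by (intro cong_mult cong_refl y')
    ultimately have c0y: "[c0 * y = z] (mod int q)" by (simp add: cong_def mult_ac)
    have uniq: "[z - c * y = 0] (mod int q) \<longleftrightarrow> c = c0" if "c \<in> {0..<int q}" for c
    proof
      assume "[z - c * y = 0] (mod int q)"
      then have "[c * y = z] (mod int q)" by (simp add: cong_iff_dvd_diff dvd_diff_commute)
      then have "[c * y = c0 * y] (mod int q)" using c0y by (meson cong_sym cong_trans)
      then have "[c = c0] (mod int q)" using co by (simp add: cong_mult_rcancel)
      then show "c = c0" using that c0 by (simp add: cong_def)
    next
      assume "c = c0" then show "[z - c * y = 0] (mod int q)"
        using c0y by (simp add: cong_iff_dvd_diff dvd_diff_commute)
    qed
    have "?I' = (\<Sum>c=0..<int q. if c = c0 then int q * (r y (c * y) - r 0 0) else 0)"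
      by (intro sum.cong) (use uniq in auto)
    also have "\<dots> = int q * (r y (c0 * y) - r 0 0)" using c0 by simp
    also have "[\<dots> = int q * (r y z - r 0 0)] (mod m)"
      by (intro cong_mult cong_diff cong_refl r c0y)
    finally show ?thesis using False by simp
  qed
  then show ?thesis using IL by (meson cong_sym cong_trans)
qed

section \<open>Functions induced by a clone that contains the addition\<close>

abbreviation residue_tuple :: "int \<Rightarrow> nat \<Rightarrow> (nat \<Rightarrow> int) \<Rightarrow> int list" where
  "residue_tuple m n z \<equiv> map (\<lambda>i. z i mod m) [0..<n]"

text \<open>
  An operation is represented by a function of a sequence of integers, of which it reads an
  initial segment mod \<open>m\<close>. This frees substitutions from any bookkeeping of arities, and a
  function is identified with all functions congruent to it.
\<close>

definition term_functions :: "int \<Rightarrow> int operation set \<Rightarrow> ((nat \<Rightarrow> int) \<Rightarrow> int) set" where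
  "term_functions m D = {F. \<exists>n f. (n, f) \<in> D \<and> (\<forall>z. [F z = f (residue_tuple m n z)] (mod m))}"

locale additive_clone =
  fixes m :: int and D :: "int operation set"
  assumes modulus_pos: "m > 0"
    and clone: "clone_on {0..<m} D"
    and addition: "(2, \<lambda>xs\<in>tuples {0..<m} 2. (xs ! 0 + xs ! 1) mod m) \<in> D"
begin

lemma residue_tuple_in_tuples: "residue_tuple m n z \<in> tuples {0..<m} n"
  using modulus_pos by (auto simp: tuples_def)

lemma value_in_carrier:
  assumes "(n, f) \<in> D"
  shows "f (residue_tuple m n z) \<in> {0..<m}"
  using assms clone residue_tuple_in_tuples[where n = n and z = z]
  by (auto simp: clone_on_def operations_def PiE_def Pi_def)

lemma compose_in_clone:
  assumes f: "(n, f) \<in> D" and g: "\<And>i. i < n \<Longrightarrow> (M, g i) \<in> D"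
  shows "\<exists>h. (M, h) \<in> D \<and>
    (\<forall>z. h (residue_tuple m M z) = f (map (\<lambda>i. g i (residue_tuple m M z)) [0..<n]))"
proof -
  let ?gs = "map (\<lambda>i. (M, g i)) [0..<n]"
  have "composition {0..<m} M (n, f) ?gs \<in> D"
    using clone f g unfolding clone_on_def by auto
  then show ?thesis
    using residue_tuple_in_tuples by (fastforce simp: composition_def comp_def)
qed

lemma rename_in_clone:
  assumes f: "(n, f) \<in> D" and \<sigma>: "\<And>i. i < n \<Longrightarrow> \<sigma> i < M"
  shows "\<exists>h. (M, h) \<in> D \<and>
    (\<forall>z. h (residue_tuple m M z) = f (residue_tuple m n (\<lambda>i. z (\<sigma> i))))"
proof -
  let ?g = "\<lambda>i. snd (projection {0..<m} M (\<sigma> i))"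
  have "(M, ?g i) \<in> D" if "i < n" for i
    using clone \<sigma>[OF that] by (auto simp: clone_on_def projection_def)
  from compose_in_clone[of n f M ?g, OF f this] obtain h where h: "(M, h) \<in> D"
    "\<And>z. h (residue_tuple m M z) = f (map (\<lambda>i. ?g i (residue_tuple m M z)) [0..<n])" by blast
  have "map (\<lambda>i. ?g i (residue_tuple m M z)) [0..<n] = residue_tuple m n (\<lambda>i. z (\<sigma> i))" for z
    using residue_tuple_in_tuples[where n = M and z = z] \<sigma> by (auto simp: projection_def)
  then have "h (residue_tuple m M z) = f (residue_tuple m n (\<lambda>i. z (\<sigma> i)))" for z
    unfolding h(2) by (rule arg_cong)
  then show ?thesis using h(1) by blast
qed

lemma term_functionsE:
  assumes "F \<in> term_functions m D"
  obtains n f where "(n, f) \<in> D" "\<And>z. [F z = f (residue_tuple m n z)] (mod m)"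
  using assms by (auto simp: term_functions_def)

lemma term_functions_eqE:
  assumes "F \<in> term_functions m D"
  obtains n f where "(n, f) \<in> D" "\<And>z. F z mod m = f (residue_tuple m n z)"
proof -
  obtain n f where f: "(n, f) \<in> D" "\<And>z. [F z = f (residue_tuple m n z)] (mod m)"
    using term_functionsE[OF assms] by metis
  have "F z mod m = f (residue_tuple m n z)" for z
    using f(2)[of z] value_in_carrier[OF f(1), of z] by (simp add: cong_def)
  then show ?thesis using that f(1) by blast
qed

lemma term_functions_cong:
  assumes "F \<in> term_functions m D" and "\<And>z. [G z = F z] (mod m)"
  shows "G \<in> term_functions m D"
  using assms unfolding term_functions_def by (blast intro: cong_trans)

lemma term_functions_respects:
  assumes "F \<in> term_functions m D" and "\<And>i. [z i = z' i] (mod m)"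
  shows "[F z = F z'] (mod m)"
proof -
  obtain n f where f: "(n, f) \<in> D" "\<And>z. F z mod m = f (residue_tuple m n z)"
    using term_functions_eqE[OF assms(1)] by metis
  have "residue_tuple m n z = residue_tuple m n z'"
    using assms(2) by (simp add: cong_def)
  then show ?thesis unfolding cong_def f(2) by (rule arg_cong)
qed

lemma term_functions_finitary:
  assumes "F \<in> term_functions m D"
  shows "\<exists>n. \<forall>z z'. (\<forall>i<n. z i = z' i) \<longrightarrow> [F z = F z'] (mod m)"
proof -
  obtain n f where f: "(n, f) \<in> D" "\<And>z. F z mod m = f (residue_tuple m n z)"
    using term_functions_eqE[OF assms(1)] by metis
  have "[F z = F z'] (mod m)" if "\<forall>i<n. z i = z' i" for z z'
  proof -
    have "residue_tuple m n z = residue_tuple m n z'" using that by simp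
    then show ?thesis unfolding cong_def f(2) by (rule arg_cong)
  qed
  then show ?thesis by blast
qed

lemma term_functions_proj: "(\<lambda>z. z i) \<in> term_functions m D"
proof -
  let ?f = "snd (projection {0..<m} (Suc i) i)"
  have "(Suc i, ?f) \<in> D" using clone by (auto simp: clone_on_def projection_def)
  moreover have "[z i = ?f (residue_tuple m (Suc i) z)] (mod m)" for z
    using residue_tuple_in_tuples[where n = "Suc i" and z = z]
    by (simp add: projection_def nth_append del: upt_Suc)
  ultimately show ?thesis unfolding term_functions_def by blast
qed

lemma term_functions_subst:
  assumes F: "F \<in> term_functions m D" and H: "\<And>i. H i \<in> term_functions m D"
  shows "(\<lambda>z. F (\<lambda>i. H i z)) \<in> term_functions m D"
proof -
  obtain n f where f: "(n, f) \<in> D" "\<And>z. F z mod m = f (residue_tuple m n z)"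
    using term_functions_eqE[OF F] by metis
  have "\<forall>i. \<exists>k h. (k, h) \<in> D \<and> (\<forall>z. H i z mod m = h (residue_tuple m k z))"
    using term_functions_eqE[OF H] by metis
  then obtain k h where h: "\<And>i. (k i, h i) \<in> D" "\<And>i z. H i z mod m = h i (residue_tuple m (k i) z)"
    by metis
  define M where "M = (\<Sum>i<n. k i)"
  have "\<exists>g. (M, g) \<in> D \<and> (\<forall>z. g (residue_tuple m M z) = h i (residue_tuple m (k i) z))"
    if "i < n" for i
  proof (rule rename_in_clone[where \<sigma> = "\<lambda>j. j"])
    show "j < M" if "j < k i" for j
      using member_le_sum[of i "{..<n}" k] \<open>i < n\<close> that by (simp add: M_def)
  qed (rule h)
  then obtain g where g: "\<And>i. i < n \<Longrightarrow> (M, g i) \<in> D"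
    "\<And>i z. i < n \<Longrightarrow> g i (residue_tuple m M z) = H i z mod m"
    unfolding h(2) by metis
  from compose_in_clone[of n f M g, OF f(1) g(1)] obtain w where w: "(M, w) \<in> D"
    "\<And>z. w (residue_tuple m M z) = f (map (\<lambda>i. g i (residue_tuple m M z)) [0..<n])" by blast
  have "[F (\<lambda>i. H i z) = w (residue_tuple m M z)] (mod m)" for z
  proof -
    have "map (\<lambda>i. g i (residue_tuple m M z)) [0..<n] = residue_tuple m n (\<lambda>i. H i z)"
      using g(2) by simp
    then have "w (residue_tuple m M z) = F (\<lambda>i. H i z) mod m"
      unfolding w(2) f(2) by (rule arg_cong)
    then show ?thesis by (simp add: cong_def)
  qed
  then show ?thesis using w(1) by (auto simp: term_functions_def)
qed

lemma term_functions_add: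
  assumes "F \<in> term_functions m D" and "G \<in> term_functions m D"
  shows "(\<lambda>z. F z + G z) \<in> term_functions m D"
proof -
  have "[z 0 + z 1 = (\<lambda>xs\<in>tuples {0..<m} 2. (xs ! 0 + xs ! 1) mod m) (residue_tuple m 2 z)] (mod m)" for z
    using residue_tuple_in_tuples[where n = 2 and z = z] by (simp add: cong_def mod_add_eq)
  then have "(\<lambda>z. z 0 + z 1) \<in> term_functions m D"
    using addition unfolding term_functions_def by blast
  from term_functions_subst[OF this, of "\<lambda>i. if i = 0 then F else G"] assms
  show ?thesis by simp
qed

text \<open>
  Only positive multiples are iterated sums, and every residue class mod \<open>m\<close> contains a
  positive integer.
\<close>

lemma term_functions_scale:
  assumes F: "F \<in> term_functions m D"
  shows "(\<lambda>z. c * F z) \<in> term_functions m D"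
proof -
  have *: "(\<lambda>z. int (Suc k) * F z) \<in> term_functions m D" for k
  proof (induction k)
    case (Suc k)
    from term_functions_add[OF this F] show ?case by (simp add: algebra_simps)
  qed (use F in simp)
  have "[c = int (Suc (nat ((c - 1) mod m)))] (mod m)"
    using modulus_pos by (simp add: cong_def mod_simps)
  then show ?thesis
    by (intro term_functions_cong[OF *] cong_scalar_right)
qed

text \<open>
  The representation forgets the arity, but an operation of positive arity is recovered from
  the function it induces: superfluous variables can be replaced by the variable with index 0.
\<close>

lemma mem_clone_if_term_function:
  assumes f: "(n, f) \<in> operations {0..<m}" and n: "n > 0"
    and F: "(\<lambda>z. f (residue_tuple m n z)) \<in> term_functions m D"
  shows "(n, f) \<in> D"
proof -
  obtain k h where h: "(k, h) \<in> D" "\<And>z. f (residue_tuple m n z) mod m = h (residue_tuple m k z)"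
    using term_functions_eqE[OF F] by metis
  have "\<exists>g. (n, g) \<in> D \<and> (\<forall>z. g (residue_tuple m n z) = h (residue_tuple m k (\<lambda>i. z (if i < n then i else 0))))"
    using rename_in_clone[OF h(1), of "\<lambda>i. if i < n then i else 0" n] n by simp
  then obtain g where g: "(n, g) \<in> D"
    "\<And>z. g (residue_tuple m n z) = h (residue_tuple m k (\<lambda>i. z (if i < n then i else 0)))" by blast
  have fE: "f \<in> tuples {0..<m} n \<rightarrow>\<^sub>E {0..<m}" using f by (simp add: operations_def)
  have gE: "g \<in> tuples {0..<m} n \<rightarrow>\<^sub>E {0..<m}"
    using g(1) clone by (auto simp: operations_def clone_on_def)
  have "g = f"
  proof (rule PiE_ext[OF gE fE])
    fix xs assume xs: "xs \<in> tuples {0..<m} n"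
    define z where "z i = xs ! i" for i
    have xsz: "residue_tuple m n z = xs"
      using xs by (intro nth_equalityI) (auto simp: z_def tuples_def subset_iff)
    have "residue_tuple m n (\<lambda>i. z (if i < n then i else 0)) = residue_tuple m n z" by simp
    then have "g xs = f xs mod m" using g(2)[of z] h(2) xsz by metis
    then show "g xs = f xs" using PiE_mem[OF fE xs] by simp
  qed
  then show ?thesis using g by simp
qed

end

lemma term_functions_mono: "C \<subseteq> D \<Longrightarrow> term_functions m C \<subseteq> term_functions m D"
  unfolding term_functions_def by blast

lemma low_arity_term_function:
  assumes C: "additive_clone m C" and N: "N > 0" and F: "F \<in> term_functions m C"
    and low: "\<And>z z'. (\<And>i. i < N \<Longrightarrow> z i = z' i) \<Longrightarrow> [F z = F z'] (mod m)"
  shows "F \<in> term_functions m {f \<in> C. arity f \<le> N}"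
proof -
  interpret additive_clone m C by fact
  obtain n f where f: "(n, f) \<in> C" "\<And>z. [F z = f (residue_tuple m n z)] (mod m)"
    using term_functionsE[OF F] by metis
  let ?\<sigma> = "\<lambda>i. if i < N then i else 0"
  have "\<exists>g. (N, g) \<in> C \<and> (\<forall>z. g (residue_tuple m N z) = f (residue_tuple m n (\<lambda>i. z (?\<sigma> i))))"
    using rename_in_clone[OF f(1), of ?\<sigma> N] N by simp
  then obtain g where g: "(N, g) \<in> C"
    "\<And>z. g (residue_tuple m N z) = f (residue_tuple m n (\<lambda>i. z (?\<sigma> i)))" by blast
  have "[F z = g (residue_tuple m N z)] (mod m)" for z
  proof -
    have "[F z = F (\<lambda>i. z (?\<sigma> i))] (mod m)" by (rule low) simp
    then show ?thesis unfolding g(2) using f(2) cong_trans by blast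
  qed
  then show ?thesis using g(1) unfolding term_functions_def by fastforce
qed

section \<open>Splitting operations by the Chinese remainder theorem\<close>

text \<open>
  The values mod \<open>p\<close> of the functions induced by \<open>D\<close>, when every variable is split into a
  component \<open>x\<^sub>i\<close> that counts mod \<open>p\<close> and a component \<open>y\<^sub>i\<close> that counts mod \<open>q\<close>. Here \<open>e\<close> is meant to
  be congruent to 1 mod \<open>p\<close> and to 0 mod \<open>q\<close>. The values mod \<open>q\<close> are described by the same
  notion with \<open>1 - e\<close> in place of \<open>e\<close> and the two sequences exchanged.
\<close>

definition part :: "nat \<Rightarrow> int \<Rightarrow> int \<Rightarrow> int operation set \<Rightarrow> ((nat \<Rightarrow> int) \<Rightarrow> (nat \<Rightarrow> int) \<Rightarrow> int) set" where
  "part p m e D = {g. \<exists>F \<in> term_functions m D. \<forall>x y. [g x y = F (\<lambda>i. e * x i + (1 - e) * y i)] (mod int p)}"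

definition depends_on :: "nat \<Rightarrow> nat \<Rightarrow> nat set \<Rightarrow> nat set \<Rightarrow> ((nat \<Rightarrow> int) \<Rightarrow> (nat \<Rightarrow> int) \<Rightarrow> int) \<Rightarrow> bool" where
  "depends_on p q I K g \<longleftrightarrow> (\<forall>x x' y y'. (\<forall>i\<in>I. [x i = x' i] (mod int p)) \<longrightarrow>
     (\<forall>i\<in>K. [y i = y' i] (mod int q)) \<longrightarrow> [g x y = g x' y'] (mod int p))"

lemma depends_onD:
  assumes "depends_on p q I K g"
    and "\<And>i. i \<in> I \<Longrightarrow> [x i = x' i] (mod int p)" and "\<And>i. i \<in> K \<Longrightarrow> [y i = y' i] (mod int q)"
  shows "[g x y = g x' y'] (mod int p)"
  using assms by (auto simp: depends_on_def)

locale split_clone = additive_clone m D for m D +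
  fixes p q :: nat and e :: int
  assumes prime_p: "prime p" and prime_q: "prime q" and m_eq: "m = int p * int q"
    and e_p: "[e = 1] (mod int p)" and e_q: "[e = 0] (mod int q)"
begin

abbreviation "P \<equiv> part p m e D"
abbreviation "Q \<equiv> part q m (1 - e) D"

lemma complement_p: "[1 - e = 0] (mod int p)"
  using cong_diff[OF cong_refl e_p, of 1] by simp

lemma complement_q: "[1 - e = 1] (mod int q)"
  using cong_diff[OF cong_refl e_q, of 1] by simp

lemma complement: "split_clone m D q p (1 - e)"
  by unfold_locales (use prime_p prime_q m_eq complement_p complement_q in auto)

lemma coprime_pq: "coprime (int p) (int q)"
proof -
  have "p \<noteq> q"
  proof
    assume "p = q"
    then have "[1 = 0] (mod int p)" using cong_trans[OF cong_sym[OF e_p]] e_q by simp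
    then show False using prime_p by (simp add: cong_0_iff)
  qed
  then show ?thesis using primes_coprime[OF prime_p prime_q] by simp
qed

lemma cong_mod_p: "[a = b] (mod m) \<Longrightarrow> [a = b] (mod int p)"
  unfolding m_eq by (rule cong_dvd_modulus) auto

lemma mix_cong_p: "[e * a + (1 - e) * b = a] (mod int p)"
  using cong_add[OF cong_scalar_right[OF e_p] cong_scalar_right[OF complement_p]] by simp

lemma mix_cong_q: "[e * a + (1 - e) * b = b] (mod int q)"
  using cong_add[OF cong_scalar_right[OF e_q] cong_scalar_right[OF complement_q]] by simp

lemma crt_cong:
  assumes "[a = a'] (mod int p)" and "[b = b'] (mod int q)"
  shows "[e * a + (1 - e) * b = e * a' + (1 - e) * b'] (mod m)"
proof -
  have "[e * a + (1 - e) * b = e * a' + (1 - e) * b'] (mod int p)"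
    by (rule cong_trans[OF mix_cong_p cong_trans[OF assms(1) cong_sym[OF mix_cong_p]]])
  moreover have "[e * a + (1 - e) * b = e * a' + (1 - e) * b'] (mod int q)"
    by (rule cong_trans[OF mix_cong_q cong_trans[OF assms(2) cong_sym[OF mix_cong_q]]])
  ultimately show ?thesis unfolding m_eq by (rule coprime_cong_mult) (rule coprime_pq)
qed

lemma partI:
  assumes "F \<in> term_functions m D"
    and "\<And>x y. [g x y = F (\<lambda>i. e * x i + (1 - e) * y i)] (mod int p)"
  shows "g \<in> P"
  using assms by (auto simp: part_def)

lemma partE:
  assumes "g \<in> P"
  obtains F where "F \<in> term_functions m D"
    and "\<And>x y. [g x y = F (\<lambda>i. e * x i + (1 - e) * y i)] (mod int p)"
  using assms by (auto simp: part_def)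

lemma part_cong:
  assumes "g \<in> P" and "\<And>x y. [g' x y = g x y] (mod int p)"
  shows "g' \<in> P"
  by (rule partE[OF assms(1)]) (rule partI, assumption, rule cong_trans[OF assms(2)])

lemma part_proj: "(\<lambda>x y. x i) \<in> P"
  by (rule partI[OF term_functions_proj[of i]]) (rule cong_sym[OF mix_cong_p])

text \<open>
  The substituted functions are only known mod \<open>p\<close> and mod \<open>q\<close>, respectively. This suffices,
  since \<open>e h + (1 - e) k\<close> depends on \<open>h\<close> mod \<open>p\<close> and on \<open>k\<close> mod \<open>q\<close> only.
\<close>

lemma part_subst:
  assumes g: "g \<in> P" and h: "\<And>i. h i \<in> P" and k: "\<And>i. k i \<in> Q"
  shows "(\<lambda>x y. g (\<lambda>i. h i x y) (\<lambda>i. k i y x)) \<in> P"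
proof -
  interpret compl: split_clone m D q p "1 - e" by (rule complement)
  obtain F where F: "F \<in> term_functions m D"
    "\<And>x y. [g x y = F (\<lambda>i. e * x i + (1 - e) * y i)] (mod int p)" using partE[OF g] by metis
  have "\<exists>H. H \<in> term_functions m D \<and>
      (\<forall>x y. [h i x y = H (\<lambda>i. e * x i + (1 - e) * y i)] (mod int p))" for i
    by (rule partE[OF h[of i]]) blast
  then obtain H where H: "\<And>i. H i \<in> term_functions m D"
    "\<And>i x y. [h i x y = H i (\<lambda>i. e * x i + (1 - e) * y i)] (mod int p)" by metis
  have "\<exists>K. K \<in> term_functions m D \<and>
      (\<forall>y x. [k i y x = K (\<lambda>i. e * x i + (1 - e) * y i)] (mod int q))" for i
    by (rule compl.partE[OF k[of i]]) (auto simp: add.commute)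
  then obtain K where K: "\<And>i. K i \<in> term_functions m D"
    "\<And>i y x. [k i y x = K i (\<lambda>i. e * x i + (1 - e) * y i)] (mod int q)" by metis
  have "(\<lambda>z. F (\<lambda>i. e * H i z + (1 - e) * K i z)) \<in> term_functions m D"
    by (intro term_functions_subst[OF F(1)] term_functions_add term_functions_scale H K)
  then show ?thesis
    by (rule partI) (rule cong_trans[OF F(2)], rule cong_mod_p,
        intro term_functions_respects[OF F(1)] crt_cong H K)
qed

lemma part_subst_x:
  assumes "g \<in> P" and "\<And>i. h i \<in> P"
  shows "(\<lambda>x y. g (\<lambda>i. h i x y) y) \<in> P"
proof -
  interpret compl: split_clone m D q p "1 - e" by (rule complement)
  show ?thesis by (rule part_subst[of g h "\<lambda>i y x. y i"]) (intro assms compl.part_proj)+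
qed

lemma part_subst_y:
  assumes "g \<in> P" and "\<And>i. k i \<in> Q"
  shows "(\<lambda>x y. g x (\<lambda>i. k i y x)) \<in> P"
  by (rule part_subst[of g "\<lambda>i x y. x i" k]) (intro assms part_proj)+

lemma part_rename: "g \<in> P \<Longrightarrow> (\<lambda>x y. g (\<lambda>i. x (\<sigma> i)) y) \<in> P"
  by (rule part_subst_x) (auto intro: part_proj)

lemma part_update_x:
  assumes "g \<in> P" and "h \<in> P"
  shows "(\<lambda>x y. g (x(i := h x y)) y) \<in> P"
proof -
  have "(\<lambda>x y. g (\<lambda>j. (if j = i then h else (\<lambda>x y. x j)) x y) y) \<in> P"
    by (rule part_subst_x) (use assms part_proj in auto)
  moreover have "(\<lambda>j. (if j = i then h else (\<lambda>x y. x j)) x y) = x(i := h x y)" for x y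
    by auto
  ultimately show ?thesis by simp
qed

lemma part_update_y:
  assumes "g \<in> P" and "k \<in> Q"
  shows "(\<lambda>x y. g x (y(i := k y x))) \<in> P"
proof -
  interpret compl: split_clone m D q p "1 - e" by (rule complement)
  have "(\<lambda>x y. g x (\<lambda>j. (if j = i then k else (\<lambda>y x. y j)) y x)) \<in> P"
    by (rule part_subst_y) (use assms compl.part_proj in auto)
  moreover have "(\<lambda>j. (if j = i then k else (\<lambda>y x. y j)) y x) = y(i := k y x)" for x y
    by auto
  ultimately show ?thesis by simp
qed

lemma part_add:
  assumes "g \<in> P" and "h \<in> P"
  shows "(\<lambda>x y. g x y + h x y) \<in> P"
  by (rule partE[OF assms(1)], rule partE[OF assms(2)], rule partI[OF term_functions_add], assumption+)
     (rule cong_add)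

lemma part_scale:
  assumes "g \<in> P"
  shows "(\<lambda>x y. c * g x y) \<in> P"
  by (rule partE[OF assms], rule partI[OF term_functions_scale], assumption) (rule cong_scalar_left)

lemma part_diff:
  assumes "g \<in> P" and "h \<in> P"
  shows "(\<lambda>x y. g x y - h x y) \<in> P"
  using part_add[OF assms(1) part_scale[OF assms(2), of "- 1"]] by simp

lemma part_zero: "(\<lambda>x y. 0) \<in> P"
  using part_scale[OF part_proj, of 0] by simp

lemma part_sum:
  assumes "\<And>a. a \<in> A \<Longrightarrow> g a \<in> P"
  shows "(\<lambda>x y. \<Sum>a\<in>A. g a x y) \<in> P"
  using assms by (induction A rule: infinite_finite_induct) (auto intro: part_zero part_add)

lemma part_cancel_scalar:
  assumes "(\<lambda>x y. c * g x y) \<in> P" and "\<not> [c = 0] (mod int p)"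
  shows "g \<in> P"
proof -
  obtain c' where c': "[c * c' = 1] (mod int p)"
    using cong_solve_coprime_int[OF coprime_int_prime[OF prime_p assms(2)]] by blast
  show ?thesis
  proof (rule part_cong[OF part_scale[OF assms(1), of c']])
    fix x y
    show "[g x y = c' * (c * g x y)] (mod int p)"
      using cong_scalar_right[OF cong_sym[OF c'], of "g x y"] by (simp add: mult_ac)
  qed
qed

lemma part_finitary:
  assumes "g \<in> P"
  obtains n where "depends_on p q {..<n} {..<n} g"
proof -
  obtain F where F: "F \<in> term_functions m D"
    "\<And>x y. [g x y = F (\<lambda>i. e * x i + (1 - e) * y i)] (mod int p)" using partE[OF assms] by metis
  obtain n where n: "\<And>z z'. (\<And>i. i < n \<Longrightarrow> z i = z' i) \<Longrightarrow> [F z = F z'] (mod m)"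
    using term_functions_finitary[OF F(1)] by blast
  have "[g x y = g x' y'] (mod int p)"
    if x: "\<And>i. i < n \<Longrightarrow> [x i = x' i] (mod int p)" and y: "\<And>i. i < n \<Longrightarrow> [y i = y' i] (mod int q)" for x x' y y'
  proof -
    define z where "z i = (if i < n then e * x i + (1 - e) * y i else e * x' i + (1 - e) * y' i)" for i
    have "[F (\<lambda>i. e * x i + (1 - e) * y i) = F z] (mod m)" by (rule n) (simp add: z_def)
    moreover have "[F z = F (\<lambda>i. e * x' i + (1 - e) * y' i)] (mod m)"
      by (rule term_functions_respects[OF F(1)]) (auto simp: z_def intro!: crt_cong x y)
    ultimately have "[F (\<lambda>i. e * x i + (1 - e) * y i) = F (\<lambda>i. e * x' i + (1 - e) * y' i)] (mod int p)"
      by (rule cong_mod_p[OF cong_trans])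
    from cong_trans[OF F(2) cong_trans[OF this cong_sym[OF F(2)]]] show ?thesis .
  qed
  then have "depends_on p q {..<n} {..<n} g" by (simp add: depends_on_def)
  then show ?thesis by (rule that)
qed

text \<open>
  Replacing \<open>x\<^sub>i\<close> by \<open>x\<^sub>i + \<mu> x\<^sub>k\<close> and combining over \<open>\<mu>\<close> yields \<open>d x\<^sub>i^(d-1) x\<^sub>k w\<close>, and
  \<open>d\<close> is invertible mod \<open>p\<close>.
\<close>

lemma part_polarise:
  assumes g: "(\<lambda>x y. x i ^ d * w x y) \<in> P" and d: "2 \<le> d" "d \<le> p - 1"
    and w: "\<And>x y t. [w (x(i := t)) y = w x y] (mod int p)"
  shows "(\<lambda>x y. x i ^ (d - 1) * x k * w x y) \<in> P"
proof -
  have "(\<lambda>x y. (x i + \<mu> * x k) ^ d * w x y) \<in> P" for \<mu>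
  proof -
    have "(\<lambda>x y. x i + \<mu> * x k) \<in> P" by (intro part_add part_scale part_proj)
    from part_update_x[OF g this, of i] show ?thesis
      by (rule part_cong) (simp add: cong_scalar_left cong_sym[OF w])
  qed
  then have "(\<lambda>x y. \<Sum>\<mu>=0..<int p. - (\<mu> ^ (p - 2)) * ((x i + \<mu> * x k) ^ d * w x y - x i ^ d * w x y)) \<in> P"
    by (intro part_sum part_scale part_diff g)
  then have "(\<lambda>x y. int d * (x i ^ (d - 1) * x k * w x y)) \<in> P"
  proof (rule part_cong)
    fix x y
    have "[int d * x i ^ (d - 1) * x k * w x y =
        (\<Sum>\<mu>=0..<int p. - (\<mu> ^ (p - 2)) * ((x i + \<mu> * x k) ^ d - x i ^ d)) * w x y] (mod int p)"
      by (intro cong_scalar_right cong_sym[OF polarisation_cong] prime_p d)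
    then show "[int d * (x i ^ (d - 1) * x k * w x y) =
        (\<Sum>\<mu>=0..<int p. - (\<mu> ^ (p - 2)) * ((x i + \<mu> * x k) ^ d * w x y - x i ^ d * w x y))] (mod int p)"
      by (simp only: sum_distrib_right left_diff_distrib right_diff_distrib mult.assoc)
  qed
  moreover have "\<not> [int d = 0] (mod int p)"
    using d by (auto simp: cong_0_iff dest: dvd_imp_le)
  ultimately show ?thesis by (rule part_cancel_scalar)
qed

lemma part_polarise_completely:
  assumes g: "(\<lambda>x y. x i ^ d * w x y) \<in> P" and d: "d \<le> p - 1"
    and w: "\<And>x y t. [w (x(i := t)) y = w x y] (mod int p)"
    and K: "finite K" "i \<notin> K" "card K < d"
  shows "(\<lambda>x y. x i ^ (d - card K) * ((\<Prod>j\<in>K. x j) * w x y)) \<in> P"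
  using K
proof (induction K)
  case empty
  then show ?case using g by simp
next
  case (insert k K)
  let ?w = "\<lambda>x y. (\<Prod>j\<in>K. x j) * w x y"
  have "(\<lambda>x y. x i ^ (d - card K) * ?w x y) \<in> P" using insert by simp
  then have "(\<lambda>x y. x i ^ (d - card K - 1) * x k * ?w x y) \<in> P"
  proof (rule part_polarise)
    show "[?w (x(i := t)) y = ?w x y] (mod int p)" for x y t
    proof -
      have "(\<Prod>j\<in>K. (x(i := t)) j) = (\<Prod>j\<in>K. x j)" using insert.prems by (intro prod.cong) auto
      then show ?thesis using w[of x t y] by (simp add: cong_scalar_left)
    qed
  qed (use insert d in auto)
  moreover have "d - card K - 1 = d - card (insert k K)" using insert by simp
  ultimately show ?case using insert by (simp add: mult_ac)
qed

end

lemma prod_lessThan_add: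
  fixes f :: "nat \<Rightarrow> int"
  shows "(\<Prod>i<a + b. f i) = (\<Prod>i<a. f i) * (\<Prod>i<b. f (a + i))"
  by (induction b) (simp_all add: mult_ac)

lemma prod_min_eq:
  fixes x :: "nat \<Rightarrow> int"
  shows "(\<Prod>i<a + b. x (min i a)) = (\<Prod>i<a. x i) * x a ^ b"
  by (simp add: prod_lessThan_add)

section \<open>Reduction to few variables\<close>

lemma homogeneous_part_cong:
  assumes "\<And>t. [k t = k' t] (mod int p)"
  shows "[homogeneous_part p d k s = homogeneous_part p d k' s] (mod int p)"
  unfolding homogeneous_part_def cong_minus_minus_iff
  by (intro cong_sum cong_scalar_left cong_diff assms)

text \<open>
  The inclusion of the parts of one clone in those of another is to be deduced from the case
  of functions of at most \<open>N\<close> variables of each kind. The bound \<open>N\<close> is kept apart from \<open>p\<close>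
  because both primes are to be treated with the same bound \<open>max p q\<close>.
\<close>

locale clone_with_low_arity_subclone =
  big: split_clone m C p q e + small: split_clone m D p q e
  for m C D p q e +
  fixes N :: nat
  assumes p_le: "p \<le> N"
    and low_arity: "\<And>g. g \<in> part p m e C \<Longrightarrow> depends_on p q {..<N} {..<N} g \<Longrightarrow> g \<in> part p m e D"
begin

lemma p_gt_1: "p > 1"
  using big.prime_p prime_gt_1_nat by blast

text \<open>
  This bounds the degree by \<open>N\<close>. With \<open>c = d - p\<close>, merging the last \<open>p\<close> variables shows that
  the product of degree \<open>c + 1 < d\<close> lies in the larger part, hence by induction in the smaller
  one. There it is substituted into its own last variable, which raises the degree by \<open>c\<close> and
  the power of \<open>r\<close> by one. At the \<open>p\<close>-th power of \<open>r\<close> the degree is \<open>p c + 1 \<ge> d\<close>, and the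
  excess \<open>(c - 1) (p - 1)\<close> is absorbed by merging variables.
\<close>

lemma initial_product_transfer:
  assumes r: "\<And>a b. [a = b] (mod int q) \<Longrightarrow> [r a = r b] (mod int p)"
    and g: "(\<lambda>x y. (\<Prod>j<d. x j) * r (y 0)) \<in> big.P"
  shows "(\<lambda>x y. (\<Prod>j<d. x j) * r (y 0)) \<in> small.P"
  using g
proof (induction d rule: less_induct)
  case (less d)
  show ?case
  proof (cases "d \<le> N")
    case True
    have "depends_on p q {..<N} {..<N} (\<lambda>x y. (\<Prod>j<d. x j) * r (y 0))"
      unfolding depends_on_def
      using True p_le p_gt_1 by (auto intro!: cong_mult cong_prod r)
    then show ?thesis by (intro low_arity less.prems)
  next
    case False
    define c where "c = d - p"
    have d: "d = c + p" and c: "c \<ge> 1" using False p_le by (auto simp: c_def)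
    have "(\<lambda>x y. (\<Prod>j<c + p. x (min j c)) * r (y 0)) \<in> big.P"
      using big.part_rename[OF less.prems, of "\<lambda>j. min j c"] by (simp add: d)
    then have "(\<lambda>x y. (\<Prod>j<Suc c. x j) * r (y 0)) \<in> big.P"
    proof (rule big.part_cong)
      fix x y :: "nat \<Rightarrow> int"
      have "[x c ^ (1 + 1 * (p - 1)) = x c ^ 1] (mod int p)"
        by (rule fermat_power_shift[OF big.prime_p]) simp
      then have "[x c = x c ^ p] (mod int p)" using p_gt_1 by (simp add: cong_sym)
      then show "[(\<Prod>j<Suc c. x j) * r (y 0) = (\<Prod>j<c + p. x (min j c)) * r (y 0)] (mod int p)"
        unfolding prod_min_eq prod.lessThan_Suc by (intro cong_scalar_right cong_scalar_left)
    qed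
    then have base: "(\<lambda>x y. (\<Prod>j<Suc c. x j) * r (y 0)) \<in> small.P"
      by (rule less.IH[rotated]) (use d p_gt_1 in simp)
    have iter: "(\<lambda>x y. (\<Prod>j<Suc (Suc k * c). x j) * r (y 0) ^ Suc k) \<in> small.P" for k
    proof (induction k)
      case 0
      then show ?case using base by simp
    next
      case (Suc k)
      have "(\<lambda>x y. (\<Prod>j<Suc (Suc k * c). x (c + j)) * r (y 0) ^ Suc k) \<in> small.P"
        by (rule small.part_rename[OF Suc, of "\<lambda>j. c + j"])
      from small.part_update_x[OF base this, of c]
      have "(\<lambda>x y. (\<Prod>j<c. x j) * ((\<Prod>j<Suc (Suc k * c). x (c + j)) * r (y 0) ^ Suc k) * r (y 0)) \<in> small.P"
        by simp
      moreover have shift: "Suc (Suc (Suc k) * c) = c + Suc (Suc k * c)" by simp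
      ultimately show ?case
        unfolding shift prod_lessThan_add by (simp only: power_Suc mult_ac)
    qed
    have pc: "Suc (p * c) = (d - 1) + (1 + (c - 1) * (p - 1))"
    proof -
      obtain a b where "c = Suc a" "p = Suc b" using c p_gt_1 by (metis Suc_le_D gr0_conv_Suc less_trans zero_less_one One_nat_def)
      then show ?thesis by (simp add: d algebra_simps)
    qed
    have "(\<lambda>x y. (\<Prod>j<Suc (p * c). x j) * r (y 0) ^ p) \<in> small.P"
      using iter[of "p - 1"] p_gt_1 by simp
    from small.part_rename[OF this, of "\<lambda>j. min j (d - 1)"]
    show ?thesis
    proof (rule small.part_cong)
      fix x y :: "nat \<Rightarrow> int"
      have "[x (d - 1) ^ (1 + (c - 1) * (p - 1)) = x (d - 1) ^ 1] (mod int p)"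
        by (rule fermat_power_shift[OF big.prime_p]) simp
      moreover have "[r (y 0) ^ (1 + 1 * (p - 1)) = r (y 0) ^ 1] (mod int p)"
        by (rule fermat_power_shift[OF big.prime_p]) simp
      ultimately have "[(\<Prod>j<d - 1. x j) * x (d - 1) ^ (1 + (c - 1) * (p - 1)) * r (y 0) ^ p =
          (\<Prod>j<d - 1. x j) * x (d - 1) * r (y 0)] (mod int p)"
        using p_gt_1 by (intro cong_mult cong_refl) simp_all
      moreover have "(\<Prod>j<d - 1. x j) * x (d - 1) = (\<Prod>j<d. x j)"
        using prod.lessThan_Suc[of x "d - 1"] d c by simp
      ultimately show "[(\<Prod>j<d. x j) * r (y 0) = (\<Prod>j<Suc (p * c). x (min j (d - 1))) * r (y 0) ^ p] (mod int p)"
        unfolding pc prod_min_eq by (simp add: cong_sym)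
    qed
  qed
qed

lemma product_transfer:
  assumes J: "finite J"
    and r: "\<And>a b. [a = b] (mod int q) \<Longrightarrow> [r a = r b] (mod int p)"
    and g: "(\<lambda>x y. (\<Prod>j\<in>J. x j) * r (y 0)) \<in> big.P"
  shows "(\<lambda>x y. (\<Prod>j\<in>J. x j) * r (y 0)) \<in> small.P"
proof -
  obtain b where b: "bij_betw b {..<card J} J"
    using ex_bij_betw_nat_finite[OF J] by (auto simp: atLeast0LessThan)
  have inv: "bij_betw (inv_into {..<card J} b) J {..<card J}" using b by (rule bij_betw_inv_into)
  have "(\<lambda>x y. (\<Prod>j<card J. x j) * r (y 0)) \<in> big.P"
    using big.part_rename[OF g, of "inv_into {..<card J} b"] by (simp add: prod.reindex_bij_betw[OF inv])
  then have "(\<lambda>x y. (\<Prod>j<card J. x j) * r (y 0)) \<in> small.P"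
    by (rule initial_product_transfer[rotated]) (rule r)
  from small.part_rename[OF this, of b] show ?thesis
    by (simp add: prod.reindex_bij_betw[OF b])
qed

text \<open>
  The variables in \<open>I\<close> are eliminated one at a time: the dependence of \<open>h\<close> on \<open>x\<^sub>i\<close> is split into
  homogeneous parts, and in the part of degree \<open>d\<close> the factor \<open>x\<^sub>i^d\<close> is polarised into a
  product of \<open>d\<close> variables. These join the product over \<open>J\<close>, so that the remaining factor
  depends on fewer variables.
\<close>

lemma product_times_transfer:
  assumes "finite I" and "finite J" "I \<inter> J = {}" and "depends_on p q I {0} h"
    and "(\<lambda>x y. (\<Prod>j\<in>J. x j) * h x y) \<in> big.P"
  shows "(\<lambda>x y. (\<Prod>j\<in>J. x j) * h x y) \<in> small.P"
  using assms
proof (induction I arbitrary: J h)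
  case empty
  define r where "r t = h (\<lambda>_. 0) (\<lambda>_. t)" for t
  have hr: "[h x y = r (y 0)] (mod int p)" for x y
    unfolding r_def by (rule depends_onD[OF empty(3)]) auto
  have "(\<lambda>x y. (\<Prod>j\<in>J. x j) * r (y 0)) \<in> big.P"
    by (rule big.part_cong[OF empty(4)]) (intro cong_scalar_left cong_sym[OF hr])
  then have "(\<lambda>x y. (\<Prod>j\<in>J. x j) * r (y 0)) \<in> small.P"
    by (rule product_transfer[rotated 2])
       (use empty(1) depends_onD[OF empty(3)] in \<open>auto simp: r_def\<close>)
  then show ?case
    by (rule small.part_cong) (intro cong_scalar_left hr)
next
  case (insert i I)
  define k where "k x y t = h (x(i := t)) y" for x y t
  have k_cong: "[k x y t = k x' y' t'] (mod int p)"
    if "\<And>j. j \<in> I \<Longrightarrow> [x j = x' j] (mod int p)" "[y 0 = y' 0] (mod int q)" "[t = t'] (mod int p)" for x x' y y' t t'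
    unfolding k_def by (rule depends_onD[OF insert.prems(3)]) (use that in auto)
  have k_respects: "[k x y t = k x y t'] (mod int p)" if "[t = t'] (mod int p)" for x y t t'
    by (rule k_cong) (use that in auto)
  have iJ: "i \<notin> J" and IJ: "I \<inter> J = {}" using insert.prems by auto
  have prodJ: "(\<Prod>j\<in>J. (x(i := t)) j) = (\<Prod>j\<in>J. x j)" for x :: "nat \<Rightarrow> int" and t
    using iJ by (intro prod.cong) auto
  have upd: "(\<lambda>x y. (\<Prod>j\<in>J. x j) * k x y (\<mu> * x i)) \<in> big.P" for \<mu>
    using big.part_update_x[OF insert.prems(4) big.part_scale[OF big.part_proj[of i], of \<mu>], of i]
    by (simp only: k_def prodJ)
  have upd0: "(\<lambda>x y. (\<Prod>j\<in>J. x j) * k x y 0) \<in> big.P" using upd[of 0] by simp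
  have const: "(\<lambda>x y. (\<Prod>j\<in>J. x j) * k x y 0) \<in> small.P"
  proof (rule insert.IH[OF insert.prems(1) IJ _ upd0])
    show "depends_on p q I {0} (\<lambda>x y. k x y 0)"
      unfolding depends_on_def by (auto intro: k_cong)
  qed
  have hom: "(\<lambda>x y. (\<Prod>j\<in>J. x j) * homogeneous_part p d (k x y) (x i)) \<in> small.P"
    if d: "1 \<le> d" "d \<le> p - 1" for d
  proof -
    define w where "w x y = homogeneous_part p d (k x y) 1" for x y
    have w: "depends_on p q I {0} w"
      unfolding depends_on_def w_def by (auto intro!: homogeneous_part_cong k_cong)
    have hw: "[homogeneous_part p d (k x y) (x i) = x i ^ d * w x y] (mod int p)" for x y
      unfolding w_def by (intro homogeneous_part_eq_power_mult big.prime_p d k_respects)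
    have "(\<lambda>x y. - 1 * (\<Sum>\<mu>=0..<int p. \<mu> ^ (p - 1 - d) * ((\<Prod>j\<in>J. x j) * k x y (\<mu> * x i) - (\<Prod>j\<in>J. x j) * k x y 0))) \<in> big.P"
      by (intro big.part_scale big.part_sum big.part_diff upd upd0)
    then have "(\<lambda>x y. x i ^ d * ((\<Prod>j\<in>J. x j) * w x y)) \<in> big.P"
    proof (rule big.part_cong)
      fix x y
      have "[(\<Prod>j\<in>J. x j) * (x i ^ d * w x y) = (\<Prod>j\<in>J. x j) * homogeneous_part p d (k x y) (x i)] (mod int p)"
        by (intro cong_scalar_left cong_sym[OF hw])
      moreover have "(\<Prod>j\<in>J. x j) * homogeneous_part p d (k x y) (x i) =
          - 1 * (\<Sum>\<mu>=0..<int p. \<mu> ^ (p - 1 - d) * ((\<Prod>j\<in>J. x j) * k x y (\<mu> * x i) - (\<Prod>j\<in>J. x j) * k x y 0))"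
        by (simp add: homogeneous_part_def sum_distrib_left sum_subtractf sum_negf right_diff_distrib mult_ac)
      ultimately show "[x i ^ d * ((\<Prod>j\<in>J. x j) * w x y) =
          - 1 * (\<Sum>\<mu>=0..<int p. \<mu> ^ (p - 1 - d) * ((\<Prod>j\<in>J. x j) * k x y (\<mu> * x i) - (\<Prod>j\<in>J. x j) * k x y 0))] (mod int p)"
        by (simp only: mult.left_commute[of "x i ^ d"])
    qed
    \<comment> \<open>Fresh variables; together with \<open>x\<^sub>i\<close> itself they replace the factor \<open>x\<^sub>i^d\<close>.\<close>
    moreover obtain K where K: "finite K" "card K = d - 1" "K \<inter> insert i (I \<union> J) = {}"
    proof -
      have "infinite (- insert i (I \<union> J))" using insert.hyps(1) insert.prems(1) by (simp add: Compl_eq_Diff_UNIV)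
      from infinite_arbitrarily_large[OF this, of "d - 1"] obtain K
        where "finite K \<and> card K = d - 1 \<and> K \<subseteq> - insert i (I \<union> J)" ..
      then show ?thesis by (intro that[of K]) auto
    qed
    ultimately have "(\<lambda>x y. x i ^ (d - card K) * ((\<Prod>j\<in>K. x j) * ((\<Prod>j\<in>J. x j) * w x y))) \<in> big.P"
    proof (intro big.part_polarise_completely[where i = i and d = d and K = K
          and w = "\<lambda>x y. (\<Prod>j\<in>J. x j) * w x y"])
      show "[(\<Prod>j\<in>J. (x(i := t)) j) * w (x(i := t)) y = (\<Prod>j\<in>J. x j) * w x y] (mod int p)" for x y t
        unfolding prodJ by (intro cong_scalar_left depends_onD[OF w]) (use insert.hyps in auto)
    qed (use d in auto)
    moreover have prodU: "(\<Prod>j\<in>insert i (K \<union> J). x j) = x i * (\<Prod>j\<in>K. x j) * (\<Prod>j\<in>J. x j)" for x :: "nat \<Rightarrow> int"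
    proof -
      have "(\<Prod>j\<in>K \<union> J. x j) = (\<Prod>j\<in>K. x j) * (\<Prod>j\<in>J. x j)"
        using K insert.prems(1) by (intro prod.union_disjoint) auto
      then show ?thesis using K insert.prems(1) iJ by (simp add: mult_ac)
    qed
    ultimately have "(\<lambda>x y. (\<Prod>j\<in>insert i (K \<union> J). x j) * w x y) \<in> big.P"
      using K d by (simp add: mult_ac)
    then have "(\<lambda>x y. (\<Prod>j\<in>insert i (K \<union> J). x j) * w x y) \<in> small.P"
      by (rule insert.IH[rotated 3]) (use K insert.prems(1) insert.hyps IJ w in auto)
    \<comment> \<open>Identifying the fresh variables with \<open>x\<^sub>i\<close> undoes the polarisation.\<close>
    from small.part_rename[OF this, of "\<lambda>j. if j \<in> K then i else j"] show ?thesis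
    proof (rule small.part_cong)
      fix x y :: "nat \<Rightarrow> int"
      let ?x = "\<lambda>j. x (if j \<in> K then i else j)"
      have pJ: "(\<Prod>j\<in>J. ?x j) = (\<Prod>j\<in>J. x j)" using K by (intro prod.cong) auto
      have pK: "(\<Prod>j\<in>K. ?x j) = x i ^ (d - 1)" using K by simp
      have "x i * x i ^ (d - 1) = x i ^ d" using d power_Suc[of "x i" "d - 1"] by simp
      then have "(\<Prod>j\<in>insert i (K \<union> J). ?x j) = (\<Prod>j\<in>J. x j) * x i ^ d"
        unfolding prodU pJ pK by simp
      moreover have "[w x y = w ?x y] (mod int p)"
        by (rule depends_onD[OF w]) (use K in auto)
      then have "[(\<Prod>j\<in>J. x j) * homogeneous_part p d (k x y) (x i) = (\<Prod>j\<in>J. x j) * (x i ^ d * w ?x y)] (mod int p)"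
        by (rule cong_scalar_left[OF cong_trans[OF hw cong_scalar_left]])
      ultimately show "[(\<Prod>j\<in>J. x j) * homogeneous_part p d (k x y) (x i) =
          (\<Prod>j\<in>insert i (K \<union> J). ?x j) * w ?x y] (mod int p)"
        by (simp only: mult.assoc)
    qed
  qed
  have "(\<lambda>x y. (\<Prod>j\<in>J. x j) * k x y 0 + (\<Sum>d=1..p-1. (\<Prod>j\<in>J. x j) * homogeneous_part p d (k x y) (x i))) \<in> small.P"
    by (intro small.part_add small.part_sum const hom) auto
  then show ?case
  proof (rule small.part_cong)
    fix x y
    have "[h x y = k x y 0 + (\<Sum>d=1..p-1. homogeneous_part p d (k x y) (x i))] (mod int p)"
      using homogeneous_decomposition[where k = "k x y" and t = "x i", OF big.prime_p k_respects] by (simp add: k_def)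
    from cong_scalar_left[OF this]
    show "[(\<Prod>j\<in>J. x j) * h x y = (\<Prod>j\<in>J. x j) * k x y 0 +
        (\<Sum>d=1..p-1. (\<Prod>j\<in>J. x j) * homogeneous_part p d (k x y) (x i))] (mod int p)"
      by (simp only: distrib_left sum_distrib_left)
  qed
qed

text \<open>
  The last two \<open>y\<close>'s are restricted to the lines through the origin of their plane. Such a
  restriction has one \<open>y\<close> fewer, so the induction hypothesis applies to it, and the smaller
  part is closed under substituting a linear form for the parameter of the line.
\<close>

lemma finitary_transfer:
  assumes "g \<in> big.P" and I: "finite I" and "depends_on p q I {..<Suc n} g"
  shows "g \<in> small.P"
  using assms(1,3)
proof (induction n arbitrary: g)
  case 0
  have "{..<Suc 0} = {0}" by auto
  then show ?case
    using product_times_transfer[of I "{}" g] 0 I by simp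
next
  case (Suc n)
  interpret big_q: split_clone m C q p "1 - e" by (rule big.complement)
  interpret small_q: split_clone m D q p "1 - e" by (rule small.complement)
  let ?on_line = "\<lambda>a b x y. g x (y(n := a * y n, Suc n := b * y n))"
  have on_line: "?on_line a b \<in> small.P" for a b
  proof (rule Suc.IH)
    have lin: "(\<lambda>y x. c * y n) \<in> big_q.P" for c by (intro big_q.part_scale big_q.part_proj)
    have "(\<lambda>x y. g x (\<lambda>j. (if j = n then \<lambda>y x. a * y n else if j = Suc n then \<lambda>y x. b * y n else (\<lambda>y x. y j)) y x)) \<in> big.P"
      by (rule big.part_subst_y) (use Suc.prems(1) lin big_q.part_proj in auto)
    moreover have "(\<lambda>j. (if j = n then \<lambda>y x. a * y n else if j = Suc n then \<lambda>y x. b * y n else (\<lambda>y x. y j)) y x)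
        = y(n := a * y n, Suc n := b * y n)" for x y :: "nat \<Rightarrow> int"
      by auto
    ultimately show "?on_line a b \<in> big.P" by simp
    show "depends_on p q I {..<Suc n} (?on_line a b)"
      unfolding depends_on_def
    proof (intro allI impI)
      fix x x' y y' :: "nat \<Rightarrow> int"
      assume "\<forall>i\<in>I. [x i = x' i] (mod int p)" and y: "\<forall>i\<in>{..<Suc n}. [y i = y' i] (mod int q)"
      then show "[?on_line a b x y = ?on_line a b x' y'] (mod int p)"
        by (intro depends_onD[OF Suc.prems(2)]) (auto simp: less_Suc_eq cong_scalar_left)
    qed
  qed
  have on_line_at: "(\<lambda>x y. g x (y(n := a * l y, Suc n := b * l y))) \<in> small.P"
    if "(\<lambda>y x. l y) \<in> small_q.P" for a b l
    using small.part_update_y[OF on_line[of a b] that, of n] by (simp add: fun_upd_twist)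
  define r where "r x y a b = g x (y(n := a, Suc n := b))" for x y a b
  have r_cong: "[r x y a b = r x y a' b'] (mod int p)"
    if "[a = a'] (mod int q)" "[b = b'] (mod int q)" for x y a a' b b'
    unfolding r_def by (rule depends_onD[OF Suc.prems(2)]) (use that in auto)
  have lin: "(\<lambda>y x. a * y n + b * y (Suc n)) \<in> small_q.P" for a b
    by (intro small_q.part_add small_q.part_scale small_q.part_proj)
  have slope: "(\<lambda>x y. r x y (y n + b * (y (Suc n) - c * y n)) (c * (y n + b * (y (Suc n) - c * y n)))) \<in> small.P" for b c
    using on_line_at[OF lin[of "1 - b * c" b], where a = 1 and b = c] by (simp add: r_def algebra_simps)
  have slope0: "(\<lambda>x y. r x y (b * (y (Suc n) - c * y n)) (c * (b * (y (Suc n) - c * y n)))) \<in> small.P" for b c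
    using on_line_at[OF lin[of "- b * c" b], where a = 1 and b = c] by (simp add: r_def algebra_simps)
  have vert: "(\<lambda>x y. r x y 0 (y (Suc n) + b * y n)) \<in> small.P" for b
    using on_line_at[OF lin[of b 1], where a = 0 and b = 1] by (simp add: r_def algebra_simps)
  have vert0: "(\<lambda>x y. r x y 0 (b * y n)) \<in> small.P" for b
    using on_line_at[OF lin[of b 0], where a = 0 and b = 1] by (simp add: r_def)
  have origin: "(\<lambda>x y. r x y 0 0) \<in> small.P"
    using on_line[of 0 0] by (simp add: r_def)
  have "(\<lambda>x y. (\<Sum>c=0..<int q. \<Sum>b=0..<int q. r x y (y n + b * (y (Suc n) - c * y n)) (c * (y n + b * (y (Suc n) - c * y n)))
                                   - r x y (b * (y (Suc n) - c * y n)) (c * (b * (y (Suc n) - c * y n))))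
      + (\<Sum>b=0..<int q. r x y 0 (y (Suc n) + b * y n) - r x y 0 (b * y n))) \<in> small.P"
    by (intro small.part_add small.part_sum small.part_diff slope slope0 vert vert0)
  then have "(\<lambda>x y. int q * (r x y (y n) (y (Suc n)) - r x y 0 0)) \<in> small.P"
    by (rule small.part_cong) (intro line_interpolation_cong big.prime_q r_cong)
  moreover have "\<not> [int q = 0] (mod int p)"
    using big.coprime_pq p_gt_1 by (auto simp: cong_0_iff coprime_absorb_left)
  ultimately have "(\<lambda>x y. r x y (y n) (y (Suc n)) - r x y 0 0) \<in> small.P"
    by (rule small.part_cancel_scalar)
  from small.part_add[OF this origin] show ?case
    by (simp add: r_def)
qed

lemma part_transfer: "g \<in> big.P \<Longrightarrow> g \<in> small.P"
proof -
  assume g: "g \<in> big.P"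
  then obtain n where "depends_on p q {..<n} {..<n} g" by (rule big.part_finitary)
  then have "depends_on p q {..<n} {..<Suc n} g" unfolding depends_on_def by auto
  then show ?thesis by (rule finitary_transfer[OF g finite_lessThan])
qed

end

lemma low_arity_part:
  assumes C: "split_clone m C p q e" and N: "N > 0"
    and g: "g \<in> part p m e C" and low: "depends_on p q {..<N} {..<N} g"
  shows "g \<in> part p m e {f \<in> C. arity f \<le> N}"
proof -
  interpret split_clone m C p q e by fact
  obtain F where F: "F \<in> term_functions m C"
    "\<And>x y. [g x y = F (\<lambda>i. e * x i + (1 - e) * y i)] (mod int p)" using partE[OF g] by metis
  let ?\<sigma> = "\<lambda>i. if i < N then i else 0"
  have "(\<lambda>z. F (\<lambda>i. z (?\<sigma> i))) \<in> term_functions m {f \<in> C. arity f \<le> N}"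
  proof (rule low_arity_term_function[OF additive_clone_axioms N])
    show "(\<lambda>z. F (\<lambda>i. z (?\<sigma> i))) \<in> term_functions m C"
      by (rule term_functions_subst[OF F(1)]) (rule term_functions_proj)
    fix z z' :: "nat \<Rightarrow> int" assume "\<And>i. i < N \<Longrightarrow> z i = z' i"
    then have "(\<lambda>i. z (?\<sigma> i)) = (\<lambda>i. z' (?\<sigma> i))" using N by auto
    then show "[F (\<lambda>i. z (?\<sigma> i)) = F (\<lambda>i. z' (?\<sigma> i))] (mod m)" by simp
  qed
  moreover have "\<forall>x y. [g x y = F (\<lambda>i. e * x (?\<sigma> i) + (1 - e) * y (?\<sigma> i))] (mod int p)"
  proof (intro allI)
    fix x y
    have "[g x y = g (\<lambda>i. x (?\<sigma> i)) (\<lambda>i. y (?\<sigma> i))] (mod int p)"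
      by (rule depends_onD[OF low]) auto
    then show "[g x y = F (\<lambda>i. e * x (?\<sigma> i) + (1 - e) * y (?\<sigma> i))] (mod int p)"
      by (rule cong_trans[OF _ F(2)])
  qed
  ultimately show ?thesis unfolding part_def mem_Collect_eq
    by (intro bexI[where x = "\<lambda>z. F (\<lambda>i. z (?\<sigma> i))"])
qed

section \<open>Generation by operations of low arity\<close>

lemma generated_clone_is_clone:
  assumes "clone_on A C" and "S \<subseteq> C"
  shows "clone_on A (generated_clone A S)"
proof -
  have *: "generated_clone A S \<subseteq> C" using assms by (auto simp: generated_clone_def)
  show ?thesis unfolding clone_on_def
  proof (intro conjI allI impI ballI)
    show "generated_clone A S \<subseteq> operations A" using * assms(1) by (auto simp: clone_on_def)
    show "projection A n i \<in> generated_clone A S" if "i < n" for n i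
      using that by (auto simp: generated_clone_def clone_on_def)
    show "composition A m f gs \<in> generated_clone A S"
      if f: "f \<in> generated_clone A S" and l: "length gs = arity f"
        and gs: "\<forall>g\<in>set gs. g \<in> generated_clone A S \<and> arity g = m" for m f gs
      unfolding generated_clone_def
    proof (rule InterI, clarify)
      fix D assume D: "clone_on A D" "S \<subseteq> D"
      then have "f \<in> D" "\<forall>g\<in>set gs. g \<in> D \<and> arity g = m"
        using f gs unfolding generated_clone_def by blast+
      then show "composition A m f gs \<in> D" using D(1) l unfolding clone_on_def by blast
    qed
  qed
qed

text \<open>
  The transfer of parts is applied once for each prime, and an operation is reassembled from
  its values mod \<open>p\<close> and mod \<open>q\<close> as \<open>e G + (1 - e) H\<close>. Nullary operations have to be treated
  apart, because they cannot be recovered from the functions they induce.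
\<close>

lemma clone_le_if_low_arity_subset:
  assumes C: "split_clone m C p q e" and D: "split_clone m D p q e"
    and sub: "{f \<in> C. arity f \<le> max p q} \<subseteq> D"
  shows "C \<subseteq> D"
proof -
  interpret C: split_clone m C p q e by fact
  interpret D: split_clone m D p q e by fact
  let ?N = "max p q"
  have N: "?N > 0" using prime_gt_0_nat[OF C.prime_p] by simp
  have mono: "part r m d {f \<in> C. arity f \<le> ?N} \<subseteq> part r m d D" for r d
    using term_functions_mono[OF sub, of m] unfolding part_def by blast
  interpret P: clone_with_low_arity_subclone m C D p q e ?N
    by unfold_locales (simp, rule subsetD[OF mono low_arity_part[OF C N]])
  interpret Q: clone_with_low_arity_subclone m C D q p "1 - e" ?N
    by (intro clone_with_low_arity_subclone.intro C.complement D.complement, unfold_locales)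
       (simp, rule subsetD[OF mono low_arity_part[OF C.complement N]])
  show ?thesis
  proof
    fix f assume "f \<in> C"
    then obtain n f' where f: "f = (n, f')" "(n, f') \<in> C" by (cases f) auto
    show "f \<in> D"
    proof (cases "n = 0")
      case True
      then show ?thesis using f sub by auto
    next
      case False
      define F where "F z = f' (residue_tuple m n z)" for z
      have F: "F \<in> term_functions m C"
        using f(2) cong_refl unfolding term_functions_def F_def by blast
      have "(\<lambda>x y. F (\<lambda>i. e * x i + (1 - e) * y i)) \<in> part p m e C"
        by (rule C.partI[OF F]) simp
      from D.partE[OF P.part_transfer[OF this]] obtain G where G: "G \<in> term_functions m D"
        "\<And>x y. [F (\<lambda>i. e * x i + (1 - e) * y i) = G (\<lambda>i. e * x i + (1 - e) * y i)] (mod int p)"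
        by metis
      have "(\<lambda>y x. F (\<lambda>i. (1 - e) * y i + (1 - (1 - e)) * x i)) \<in> part q m (1 - e) C"
        by (rule split_clone.partI[OF C.complement F]) simp
      from split_clone.partE[OF D.complement Q.part_transfer[OF this]] obtain H
        where H: "H \<in> term_functions m D"
        "\<And>y x. [F (\<lambda>i. (1 - e) * y i + (1 - (1 - e)) * x i) = H (\<lambda>i. (1 - e) * y i + (1 - (1 - e)) * x i)] (mod int q)"
        by metis
      have "(\<lambda>z. e * G z + (1 - e) * H z) \<in> term_functions m D"
        by (intro D.term_functions_add D.term_functions_scale G H)
      moreover have "[F z = e * G z + (1 - e) * H z] (mod m)" for z
      proof -
        have "[F z = G z] (mod int p)" using G(2)[of z z] by (simp add: algebra_simps)
        moreover have "[F z = H z] (mod int q)" using H(2)[of z z] by (simp add: algebra_simps)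
        ultimately have "[e * F z + (1 - e) * F z = e * G z + (1 - e) * H z] (mod m)"
          by (rule D.crt_cong)
        then show ?thesis by (simp add: algebra_simps)
      qed
      ultimately have "F \<in> term_functions m D" by (rule D.term_functions_cong)
      moreover have "(n, f') \<in> operations {0..<m}" using f(2) C.clone by (auto simp: clone_on_def)
      ultimately show ?thesis
        unfolding f(1) using False by (intro D.mem_clone_if_term_function) (auto simp: F_def[abs_def])
    qed
  qed
qed

theorem corollary1p6:
  fixes p q :: nat
    and C :: "int operation set"
  assumes "prime p" and "prime q" and "p \<noteq> q"
    and "clone_on (carrier (integer_mod_group (p * q))) C"
    and "Clo (integer_mod_group (p * q)) \<subseteq> C"
  shows "\<exists>S. S \<subseteq> operations (carrier (integer_mod_group (p * q))) \<and>
             (\<forall>f\<in>S. arity f \<le> max p q) \<and>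
             generated_clone (carrier (integer_mod_group (p * q))) S = C"
proof -
  define m where "m = int p * int q"
  have m: "m > 0" using assms(1,2) by (simp add: m_def prime_gt_0_nat)
  have carrier: "carrier (integer_mod_group (p * q)) = {0..<m}"
    using assms(1,2) by (auto simp: m_def carrier_integer_mod_group)
  define S where "S = {f \<in> C. arity f \<le> max p q}"
  define D where "D = generated_clone {0..<m} S"
  have C: "clone_on {0..<m} C" using assms(4) by (simp add: carrier)
  have D: "clone_on {0..<m} D"
    unfolding D_def by (rule generated_clone_is_clone[OF C]) (auto simp: S_def)
  have SD: "S \<subseteq> D" by (auto simp: D_def generated_clone_def)
  let ?add = "(2, \<lambda>xs\<in>tuples {0..<m} 2. (xs ! 0 + xs ! 1) mod m) :: int operation"
  have "group_operation (integer_mod_group (p * q)) \<in> Clo (integer_mod_group (p * q))"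
    by (auto simp: Clo_def generated_clone_def)
  then have add_C: "?add \<in> C"
    using assms(5) by (auto simp: group_operation_def carrier m_def)
  then have add_D: "?add \<in> D"
    using SD prime_ge_2_nat[OF assms(1)] by (auto simp: S_def)
  have "coprime (int q) (int p)"
    using primes_coprime[OF assms(2,1)] assms(3) by simp
  then obtain e' where e': "[int q * e' = 1] (mod int p)" using cong_solve_coprime_int by blast
  define e where "e = int q * e'"
  have split: "split_clone m E p q e" if "clone_on {0..<m} E" "?add \<in> E" for E
    by unfold_locales (use that m assms e' in \<open>auto simp: e_def m_def cong_0_iff\<close>)
  have "C \<subseteq> D"
    by (rule clone_le_if_low_arity_subset[OF split[OF C add_C] split[OF D add_D]])
       (use SD in \<open>auto simp: S_def\<close>)
  moreover have "D \<subseteq> C" using C by (auto simp: D_def generated_clone_def S_def)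
  ultimately have "D = C" by blast
  moreover have "S \<subseteq> operations {0..<m}" using C by (auto simp: S_def clone_on_def)
  ultimately show ?thesis
    unfolding carrier by (intro exI[of _ S]) (auto simp: D_def S_def)
qed

end
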